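(* Let $N\ge 2$ and let $k>0$ be real. Consider $N$ agents $$\dot x_i=Ax_i+Bu_i,\qquad y_i=C^{\mathrm T}x_i,\qquad i=1,\dots,N,$$ $$A=\begin{pmatrix}0&0\\1&0\end{pmatrix},\quad B=\begin{pmatrix}2\\0\end{pmatrix},\quad C=\begin{pmatrix}0.5\\0.5\end{pmatrix},$$ connected in a directed cycle, with the controller $$u_i(t)=-k\,(y_i(t)-y_{i+1}(t)),\qquad i=1,\dots,N,$$ where the index $N+1$ is understood as $1$. Then the controller ensures $$\lim_{t\to\infty}(x_i(t)-x_j(t))=0,\quad i,j=1,\dots,N,$$ for all initial conditions $x_1(0),\dots,x_N(0)\in\mathbb{R}^2$ if, and only if, $$k>\frac12\cot^2\frac{\pi}{N}.$$
   Context: The directed cycle is the unit weighted digraph on nodes $S_1,\dots,S_N$ with exactly the $N$ arcs $(S_1,S_2),(S_2,S_3),\dots,(S_{N-1},S_N),(S_N,S_1)$, where in an arc $(S_i,S_j)$ agent $j$ is the neighbour whose output agent $i$ uses. The control is $u_i=-k\sum_{j\in\mathcal N_i}(y_i-y_j)$, where $\mathcal N_i$ is the set of neighbours of agent $i$ (here $\mathcal N_i=\{i+1\}$ modulo $N$). *)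

theory Defs
  imports "HOL-Analysis.Analysis"
begin

definition agent_A :: "real^2^2" where
  "agent_A = vector [vector [0, 0], vector [1, 0]]"

definition agent_B :: "real^2" where
  "agent_B = vector [2, 0]"

definition agent_C :: "real^2" where
  "agent_C = vector [1/2, 1/2]"

definition agent_output :: "real^2 \<Rightarrow> real" where
  "agent_output x = agent_C \<bullet> x"

definition directed_cycle :: "nat \<Rightarrow> (nat \<times> nat) set" where
  "directed_cycle N = {(i, i + 1) | i. 1 \<le> i \<and> i < N} \<union> {(N, 1)}"

text \<open>In an arc \<open>(i, j)\<close>, agent \<open>i\<close> uses the output of agent \<open>j\<close>.\<close>

definition neighbours :: "(nat \<times> nat) set \<Rightarrow> nat \<Rightarrow> nat set" where
  "neighbours E i = {j. (i, j) \<in> E}"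

definition control :: "(nat \<times> nat) set \<Rightarrow> real \<Rightarrow> (nat \<Rightarrow> real) \<Rightarrow> nat \<Rightarrow> real" where
  "control E k y i = - k * (\<Sum>j\<in>neighbours E i. (y i - y j))"

lemma neighbours_directed_cycle:
  assumes "i \<in> {1..N}"
  shows "neighbours (directed_cycle N) i = {if i = N then 1 else i + 1}"
  using assms by (auto simp: neighbours_def directed_cycle_def)

lemma control_directed_cycle:
  assumes "i \<in> {1..N}"
  shows "control (directed_cycle N) k y i = - k * (y i - y (if i = N then 1 else i + 1))"
  using neighbours_directed_cycle[OF assms] by (simp add: control_def)

text \<open>Agents are indexed by \<open>1, \<dots>, N\<close>; values of \<open>x\<close> at other indices are irrelevant.
  The derivative at time \<open>0\<close> is one-sided.\<close>

definition closed_loop_solution ::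
  "nat \<Rightarrow> (nat \<times> nat) set \<Rightarrow> real \<Rightarrow> (nat \<Rightarrow> real \<Rightarrow> real^2) \<Rightarrow> bool" where
  "closed_loop_solution N E k x \<longleftrightarrow>
     (\<forall>i\<in>{1..N}. \<forall>t\<ge>0.
        (x i has_vector_derivative
           agent_A *v x i t + control E k (\<lambda>j. agent_output (x j t)) i *\<^sub>R agent_B)
        (at t within {0..}))"

end

theory Submission
  imports Defs "HOL-Real_Asymp.Real_Asymp"
begin

text \<open>
  The discrete Fourier transform over the cycle turns the closed loop into the scalar modes
  \<open>s\<^sup>2 + c s + c\<close> with \<open>c = k (1 - z)\<close>, one for each \<open>N\<close>-th root of unity \<open>z\<close>. The mode
  \<open>z = 1\<close> is the average and does not affect differences, so the agents synchronize iff every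
  other mode is stable. For \<open>z = cis (2 \<theta>)\<close> the Hurwitz criterion reads \<open>k > cot\<^sup>2 \<theta> / 2\<close>, and
  among \<open>\<theta> = \<pi> m / N\<close>, \<open>0 < m < N\<close>, the case \<open>m = 1\<close> is the most restrictive.
  When that mode has a root with nonnegative real part, the real parts of its complex multiples
  are solutions that do not synchronize.
\<close>

section \<open>The closed loop in coordinates\<close>

lemma has_vector_derivative_vec2_iff:
  fixes f :: "real \<Rightarrow> real^2"
  shows "(f has_vector_derivative f') (at t within S) \<longleftrightarrow>
    ((\<lambda>t. f t $ 1) has_vector_derivative f' $ 1) (at t within S) \<and>
    ((\<lambda>t. f t $ 2) has_vector_derivative f' $ 2) (at t within S)"
proof (intro iffI conjI)
  assume "(f has_vector_derivative f') (at t within S)"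
  then show "((\<lambda>t. f t $ 1) has_vector_derivative f' $ 1) (at t within S)"
    "((\<lambda>t. f t $ 2) has_vector_derivative f' $ 2) (at t within S)"
    by (auto intro: bounded_linear.has_vector_derivative[OF bounded_linear_vec_nth])
next
  have expand: "v = v $ 1 *\<^sub>R axis 1 1 + v $ 2 *\<^sub>R axis 2 1" for v :: "real^2"
    by (simp add: vec_eq_iff forall_2 axis_def)
  assume "((\<lambda>t. f t $ 1) has_vector_derivative f' $ 1) (at t within S) \<and>
    ((\<lambda>t. f t $ 2) has_vector_derivative f' $ 2) (at t within S)"
  then have "((\<lambda>t. f t $ 1 *\<^sub>R axis 1 1 + f t $ 2 *\<^sub>R axis 2 1) has_vector_derivative
      f' $ 1 *\<^sub>R axis 1 1 + f' $ 2 *\<^sub>R axis 2 1) (at t within S)"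
    by (intro has_vector_derivative_add
          bounded_linear.has_vector_derivative[OF bounded_linear_scaleR_left]) auto
  then show "(f has_vector_derivative f') (at t within S)"
    using expand by (metis (no_types, lifting) ext)
qed

text \<open>The entry 2 of \<open>agent_B\<close> cancels the factor 1/2 in the output, so
  \<open>k\<close> multiplies the plain difference of coordinate sums; the second coordinate just
  integrates the first.\<close>

lemma closed_loop_solution_directed_cycle_iff:
  "closed_loop_solution N (directed_cycle N) k x \<longleftrightarrow>
    (\<forall>i\<in>{1..N}. \<forall>t\<ge>0.
      ((\<lambda>t. x i t $ 1) has_vector_derivative
        - k * ((x i t $ 1 + x i t $ 2)
          - (x (if i = N then 1 else i + 1) t $ 1 + x (if i = N then 1 else i + 1) t $ 2)))
        (at t within {0..}) \<and>
      ((\<lambda>t. x i t $ 2) has_vector_derivative x i t $ 1) (at t within {0..}))"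
proof -
  have out: "agent_output v = (v $ 1 + v $ 2) / 2" for v
    by (simp add: agent_output_def agent_C_def inner_vec_def sum_2 add_divide_distrib)
  have "agent_A *v x i t + control (directed_cycle N) k (\<lambda>j. agent_output (x j t)) i *\<^sub>R agent_B
    = vector [- k * ((x i t $ 1 + x i t $ 2)
          - (x (if i = N then 1 else i + 1) t $ 1 + x (if i = N then 1 else i + 1) t $ 2)), x i t $ 1]"
    if "i \<in> {1..N}" for i t
    unfolding control_directed_cycle[OF that] out
    by (simp add: vec_eq_iff forall_2 agent_A_def agent_B_def matrix_vector_mult_def sum_2 field_simps)
  then show ?thesis
    unfolding closed_loop_solution_def has_vector_derivative_vec2_iff
    by (simp only: vector_2 cong: ball_cong)
qed

section \<open>Decay of solutions of linear ODEs with complex coefficients\<close>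

text \<open>Integrating factor: \<open>exp (- t r) * g t\<close> has zero derivative on the
  half-line, hence is constant there.\<close>

lemma linear_ode_solution:
  fixes g :: "real \<Rightarrow> complex"
  assumes "\<And>t. t \<ge> 0 \<Longrightarrow> (g has_vector_derivative r * g t) (at t within {0..})" and "t \<ge> 0"
  shows "g t = exp (t *\<^sub>R r) * g 0"
proof -
  have "((\<lambda>t. exp (t *\<^sub>R (-r)) * g t) has_vector_derivative 0) (at s within {0..})"
    if "s \<in> {0..}" for s
    using has_vector_derivative_mult[OF exp_scaleR_has_vector_derivative_right[of "-r" s "{0..}"]
        assms(1)[of s]] that by (simp add: algebra_simps)
  from has_vector_derivative_zero_constant[OF _ this] obtain c
    where c: "\<And>s. s \<in> {0..} \<Longrightarrow> exp (s *\<^sub>R (-r)) * g s = c" by auto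
  from c[of 0] c[of t] assms(2) have "exp (- (t *\<^sub>R r)) * g t = g 0" by simp
  then show ?thesis by (simp add: exp_minus field_simps)
qed

text \<open>The modulus of the exponential is \<open>exp (t * Re r)\<close>. The second limit serves
  the double root, where a factor \<open>t\<close> appears.\<close>

lemma tendsto_exp_scaleR_0:
  fixes r :: complex
  assumes "Re r < 0"
  shows "((\<lambda>t. exp (t *\<^sub>R r)) \<longlongrightarrow> 0) at_top"
    and "((\<lambda>t. exp (t *\<^sub>R r) * of_real t) \<longlongrightarrow> 0) at_top"
proof -
  have "((\<lambda>t. exp (t * Re r)) \<longlongrightarrow> 0) at_top" "((\<lambda>t. exp (t * Re r) * t) \<longlongrightarrow> 0) at_top"
    using assms by real_asymp+
  then have "((\<lambda>t. norm (exp (t * Re r))) \<longlongrightarrow> 0) at_top"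
    "((\<lambda>t. norm (exp (t * Re r) * t)) \<longlongrightarrow> 0) at_top"
    unfolding tendsto_norm_zero_iff .
  then show "((\<lambda>t. exp (t *\<^sub>R r)) \<longlongrightarrow> 0) at_top" "((\<lambda>t. exp (t *\<^sub>R r) * of_real t) \<longlongrightarrow> 0) at_top"
    by (auto intro!: tendsto_norm_zero_cancel[of "\<lambda>t. exp (t *\<^sub>R r)"]
        tendsto_norm_zero_cancel[of "\<lambda>t. exp (t *\<^sub>R r) * of_real t"] simp: norm_mult abs_mult)
qed

text \<open>The combinations \<open>P - r2 * Q\<close> and \<open>P - r1 * Q\<close> decouple the
  system: each solves a first-order equation, with rate \<open>r1\<close> and \<open>r2\<close>
  respectively. Distinct roots let \<open>Q\<close> be solved from the two; for a double root they
  coincide and one more integration is needed.\<close>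

lemma second_order_ode_tendsto_0:
  fixes P Q :: "real \<Rightarrow> complex"
  assumes Q: "\<And>t. t \<ge> 0 \<Longrightarrow> (Q has_vector_derivative P t) (at t within {0..})"
    and P: "\<And>t. t \<ge> 0 \<Longrightarrow>
      (P has_vector_derivative (r1 + r2) * P t - r1 * r2 * Q t) (at t within {0..})"
    and Re: "Re r1 < 0" "Re r2 < 0"
  shows "(P \<longlongrightarrow> 0) at_top" and "(Q \<longlongrightarrow> 0) at_top"
proof -
  have PQ1: "P t - r2 * Q t = exp (t *\<^sub>R r1) * (P 0 - r2 * Q 0)" if "t \<ge> 0" for t
    using that
    by (rule linear_ode_solution[rotated])
      (auto intro!: derivative_eq_intros P Q simp: algebra_simps)
  have PQ2: "P t - r1 * Q t = exp (t *\<^sub>R r2) * (P 0 - r1 * Q 0)" if "t \<ge> 0" for t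
    using that
    by (rule linear_ode_solution[rotated])
      (auto intro!: derivative_eq_intros P Q simp: algebra_simps)
  have ev: "eventually (\<lambda>t. t \<ge> 0) (at_top :: real filter)" by (rule eventually_ge_at_top)
  show Q0: "(Q \<longlongrightarrow> 0) at_top"
  proof (cases "r1 = r2")
    case False
    \<comment> \<open>The difference of the two combinations is
      \<open>(r1 - r2) * Q t\<close>.\<close>
    have "((\<lambda>t. (exp (t *\<^sub>R r1) * (P 0 - r2 * Q 0) - exp (t *\<^sub>R r2) * (P 0 - r1 * Q 0)) / (r1 - r2))
        \<longlongrightarrow> (0 * (P 0 - r2 * Q 0) - 0 * (P 0 - r1 * Q 0)) / (r1 - r2)) at_top"
      using False by (intro tendsto_intros tendsto_exp_scaleR_0 Re) auto
    moreover have "\<forall>\<^sub>F t in at_top. (exp (t *\<^sub>R r1) * (P 0 - r2 * Q 0)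
        - exp (t *\<^sub>R r2) * (P 0 - r1 * Q 0)) / (r1 - r2) = Q t"
      using ev
    proof eventually_elim
      case (elim t)
      show ?case
        unfolding PQ1[OF elim, symmetric] PQ2[OF elim, symmetric]
        using False by (simp add: field_simps)
    qed
    ultimately show ?thesis using Lim_transform_eventually by fastforce
  next
    case True
    define d where "d = P 0 - r1 * Q 0"
    have d: "P t - r1 * Q t = exp (t *\<^sub>R r1) * d" if "t \<ge> 0" for t
      using PQ2[OF that] True d_def by simp
    \<comment> \<open>Since \<open>P\<close> is the derivative of \<open>Q\<close>, the identity
      \<open>d\<close> is itself a first-order equation for \<open>Q\<close> with resonant forcing;
      after the integrating factor, its solution is affine in \<open>t\<close> with slope
      \<open>d\<close>.\<close>
    have "((\<lambda>t. exp (t *\<^sub>R (-r1)) * Q t - t *\<^sub>R d) has_vector_derivative 0) (at s within {0..})"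
      if "s \<in> {0..}" for s
    proof -
      have "((\<lambda>t. exp (t *\<^sub>R (-r1)) * Q t - t *\<^sub>R d) has_vector_derivative
          (exp (s *\<^sub>R (-r1)) * P s + exp (s *\<^sub>R (-r1)) * (-r1) * Q s) - 1 *\<^sub>R d) (at s within {0..})"
        using that
        by (intro has_vector_derivative_diff has_vector_derivative_mult
            exp_scaleR_has_vector_derivative_right Q
            bounded_linear.has_vector_derivative[OF bounded_linear_scaleR_left])
          (auto intro: derivative_eq_intros)
      moreover have "exp (s *\<^sub>R (-r1)) * P s + exp (s *\<^sub>R (-r1)) * (-r1) * Q s
          = exp (s *\<^sub>R (-r1)) * (P s - r1 * Q s)"
        by (simp add: algebra_simps)
      ultimately show ?thesis
        using d[of s] that by (simp add: exp_minus flip: mult.assoc)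
    qed
    from has_vector_derivative_zero_constant[OF _ this] obtain c
      where c: "\<And>s. s \<in> {0..} \<Longrightarrow> exp (s *\<^sub>R (-r1)) * Q s - s *\<^sub>R d = c" by auto
    have "((\<lambda>t. exp (t *\<^sub>R r1) * c + exp (t *\<^sub>R r1) * of_real t * d) \<longlongrightarrow> 0 * c + 0 * d) at_top"
      by (intro tendsto_intros tendsto_exp_scaleR_0 Re)
    moreover have "\<forall>\<^sub>F t in at_top. exp (t *\<^sub>R r1) * c + exp (t *\<^sub>R r1) * of_real t * d = Q t"
      using ev
    proof eventually_elim
      case (elim t)
      show ?case using c[of t] elim by (auto simp: exp_minus scaleR_conv_of_real field_simps)
    qed
    ultimately show ?thesis using Lim_transform_eventually by fastforce
  qed
  have "((\<lambda>t. exp (t *\<^sub>R r1) * (P 0 - r2 * Q 0) + r2 * Q t) \<longlongrightarrow> 0 * (P 0 - r2 * Q 0) + r2 * 0) at_top"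
    by (intro tendsto_intros tendsto_exp_scaleR_0 Re Q0)
  moreover have "\<forall>\<^sub>F t in at_top. exp (t *\<^sub>R r1) * (P 0 - r2 * Q 0) + r2 * Q t = P t"
    using ev by eventually_elim (simp add: PQ1[symmetric])
  ultimately show "(P \<longlongrightarrow> 0) at_top" using Lim_transform_eventually by fastforce
qed

section \<open>Hurwitz criterion for the mode polynomial\<close>

lemma complex_quadratic_roots:
  fixes c :: complex
  obtains r1 r2 where "r1 + r2 = - c" "r1 * r2 = c"
proof
  let ?d = "csqrt (c\<^sup>2 - 4 * c)"
  show "(- c + ?d) / 2 + (- c - ?d) / 2 = - c" by (simp add: field_simps)
  have "(- c + ?d) / 2 * ((- c - ?d) / 2) = (c\<^sup>2 - ?d\<^sup>2) / 4"
    by (simp add: power2_eq_square field_simps)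
  then show "(- c + ?d) / 2 * ((- c - ?d) / 2) = c" by simp
qed

text \<open>The Hurwitz determinant of a complex quadratic equals
  \<open>Re r1 Re r2 ((Re r1 + Re r2)\<^sup>2 + (Im r1 - Im r2)\<^sup>2)\<close>, so its sign decides stability.\<close>

lemma quadratic_roots_stable_iff:
  fixes c :: complex
  assumes sum: "r1 + r2 = - c" and prod: "r1 * r2 = c" and pos: "Re c > 0"
  shows "Re r1 < 0 \<and> Re r2 < 0 \<longleftrightarrow> (Im c)\<^sup>2 < Re c * (cmod c)\<^sup>2"
proof -
  define x1 y1 x2 y2 where "x1 = Re r1" "y1 = Im r1" "x2 = Re r2" "y2 = Im r2"
  note d = this
  define a b where "a = Re c" "b = Im c"
  note ab = this
  have a1: "a = - (x1 + x2)" and b1: "b = - (y1 + y2)"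
    using sum[symmetric] by (auto simp: d ab complex_eq_iff)
  have a2: "a = x1 * x2 - y1 * y2" and b2: "b = x1 * y2 + y1 * x2"
    using prod[symmetric] by (auto simp: d ab)
  \<comment> \<open>Both coefficients of the quadratic equal \<open>c\<close>, so \<open>a\<close>
    and \<open>b\<close> each have one expression through the sum and one through the product of the
    roots. The split below picks between them so that every term has degree four in
    \<open>x1\<close>, \<open>y1\<close>, \<open>x2\<close>, \<open>y2\<close>; only then does the
    polynomial factor.\<close>
  have "a * (a\<^sup>2 + b\<^sup>2) - b\<^sup>2 = a\<^sup>2 * a + a * b * b - b\<^sup>2"
    by (simp add: power2_eq_square algebra_simps)
  also have "\<dots> = (x1 + x2)\<^sup>2 * (x1 * x2 - y1 * y2)
      + (x1 + x2) * (y1 + y2) * (x1 * y2 + y1 * x2) - (x1 * y2 + y1 * x2)\<^sup>2"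
  proof -
    have "a\<^sup>2 * a = (x1 + x2)\<^sup>2 * (x1 * x2 - y1 * y2)"
      using a1 a2 by (metis power2_minus)
    moreover have "a * b * b = (x1 + x2) * (y1 + y2) * (x1 * y2 + y1 * x2)"
      using a1 b1 b2 by (metis minus_mult_minus)
    ultimately show ?thesis using b2 by simp
  qed
  also have "\<dots> = x1 * x2 * ((x1 + x2)\<^sup>2 + (y1 - y2)\<^sup>2)"
    by (simp add: power2_eq_square algebra_simps)
  finally have id: "a * (a\<^sup>2 + b\<^sup>2) - b\<^sup>2 = x1 * x2 * ((x1 + x2)\<^sup>2 + (y1 - y2)\<^sup>2)" .
  have neg: "x1 + x2 < 0" using pos a1 ab by simp
  then have "(x1 + x2)\<^sup>2 + (y1 - y2)\<^sup>2 > 0" by (simp add: add_pos_nonneg)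
  then have "b\<^sup>2 < a * (a\<^sup>2 + b\<^sup>2) \<longleftrightarrow> x1 * x2 > 0"
    using id by (metis diff_gt_0_iff_gt zero_less_mult_pos2 mult_pos_pos)
  \<comment> \<open>The sum of the real parts is negative, so they cannot both be positive.\<close>
  moreover have "x1 * x2 > 0 \<longleftrightarrow> x1 < 0 \<and> x2 < 0"
    using neg by (auto simp: zero_less_mult_iff)
  ultimately show ?thesis by (simp add: d ab cmod_power2)
qed

section \<open>The gain threshold of each mode and its maximum\<close>

lemma cot_sqr_eq: "sin x \<noteq> 0 \<Longrightarrow> (cot x)\<^sup>2 = 1 / (sin x)\<^sup>2 - (1::real)"
  by (simp add: cot_def power_divide cos_squared_eq diff_divide_distrib)

text \<open>In the half angle, \<open>1 - cis (2 * \<theta>)\<close> has real part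
  \<open>2 * sin\<^sup>2 \<theta>\<close> and squared modulus
  \<open>4 * sin\<^sup>2 \<theta>\<close>. The positive factor
  \<open>4 * k\<^sup>2 * sin\<^sup>2 \<theta>\<close> then cancels from the Hurwitz inequality,
  leaving one that is linear in \<open>k\<close>.\<close>

lemma cycle_mode_stable_iff:
  fixes k \<theta> :: real
  assumes k: "k > 0" and s: "sin \<theta> \<noteq> 0"
    and r: "r1 + r2 = - (k *\<^sub>R (1 - cis (2 * \<theta>)))" "r1 * r2 = k *\<^sub>R (1 - cis (2 * \<theta>))"
  shows "Re r1 < 0 \<and> Re r2 < 0 \<longleftrightarrow> k > 1 / 2 * (cot \<theta>)\<^sup>2"
proof -
  let ?c = "k *\<^sub>R (1 - cis (2 * \<theta>))"
  have re: "Re ?c = 2 * k * (sin \<theta>)\<^sup>2" by (simp add: cos_double_sin)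
  have im: "Im ?c = - 2 * k * sin \<theta> * cos \<theta>" by (simp add: sin_double)
  have pos: "Re ?c > 0" unfolding re using k s by simp
  have "(cmod ?c)\<^sup>2 = 4 * k\<^sup>2 * (sin \<theta>)\<^sup>2 * ((sin \<theta>)\<^sup>2 + (cos \<theta>)\<^sup>2)"
    unfolding cmod_power2 re im by algebra
  then have n: "(cmod ?c)\<^sup>2 = 4 * k\<^sup>2 * (sin \<theta>)\<^sup>2" by simp
  have "(Im ?c)\<^sup>2 < Re ?c * (cmod ?c)\<^sup>2
      \<longleftrightarrow> (4 * k\<^sup>2 * (sin \<theta>)\<^sup>2) * (cos \<theta>)\<^sup>2 < (4 * k\<^sup>2 * (sin \<theta>)\<^sup>2) * (2 * k * (sin \<theta>)\<^sup>2)"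
    unfolding n re im by (simp add: power2_eq_square algebra_simps)
  also have "\<dots> \<longleftrightarrow> (cos \<theta>)\<^sup>2 < 2 * k * (sin \<theta>)\<^sup>2"
    using k s by (subst mult_less_cancel_left_pos) auto
  also have "\<dots> \<longleftrightarrow> k > 1 / 2 * (cot \<theta>)\<^sup>2"
    using s by (simp add: cot_def power_divide field_simps)
  finally show ?thesis using quadratic_roots_stable_iff[OF r pos] by simp
qed

text \<open>Sine increases up to \<open>pi / 2\<close>, which settles the lower half of the indices;
  the reflection of \<open>m\<close> to \<open>N - m\<close> preserves the sine and reduces the
  upper half to it.\<close>

lemma sin_multiple_pi_over_ge:
  assumes "0 < m" "m < N"
  shows "sin (pi / real N) \<le> sin (pi * real m / real N)"
proof -
  have *: "sin (pi / real N) \<le> sin (pi * real j / real N)" if "0 < j" "2 * j \<le> N" for j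
  proof -
    have "pi / real N \<le> pi * real j / real N" "pi * real j / real N \<le> pi / 2"
      using that by (auto simp: field_simps simp flip: of_nat_mult)
    moreover have "0 \<le> pi / real N" by simp
    ultimately show ?thesis by (intro sin_monotone_2pi_le) linarith+
  qed
  show ?thesis
  proof (cases "2 * m \<le> N")
    case False
    then have "sin (pi / real N) \<le> sin (pi * real (N - m) / real N)"
      using assms by (intro *) auto
    also have "pi * real (N - m) / real N = pi - pi * real m / real N"
      using assms by (simp add: of_nat_diff field_simps)
    finally show ?thesis by simp
  qed (use * assms in auto)
qed

lemma cot_sqr_multiple_le:
  assumes "0 < m" "m < N"
  shows "sin (pi * real m / real N) > 0"
    and "(cot (pi * real m / real N))\<^sup>2 \<le> (cot (pi / real N))\<^sup>2"
proof -
  have "N > 1" using assms by simp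
  then have "sin (pi / real N) > 0"
    by (intro sin_gt_zero) (auto simp: field_simps)
  with sin_multiple_pi_over_ge[OF assms]
  show pos: "sin (pi * real m / real N) > 0" by linarith
  have "1 / (sin (pi * real m / real N))\<^sup>2 \<le> 1 / (sin (pi / real N))\<^sup>2"
    using sin_multiple_pi_over_ge[OF assms] \<open>sin (pi / real N) > 0\<close>
    by (intro divide_left_mono power_mono) (auto intro!: mult_pos_pos pos)
  with pos \<open>sin (pi / real N) > 0\<close>
  show "(cot (pi * real m / real N))\<^sup>2 \<le> (cot (pi / real N))\<^sup>2"
    by (simp add: cot_sqr_eq)
qed

section \<open>Roots of unity and the Fourier transform on the cycle\<close>

definition unity_root :: "nat \<Rightarrow> complex" where
  "unity_root N = cis (2 * pi / real N)"

text \<open>The angle is left as a double so that \<open>cycle_mode_stable_iff\<close> applies with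
  \<theta> equal to \<open>pi * m / N\<close>.\<close>

lemma unity_root_power: "unity_root N ^ m = cis (2 * (pi * real m / real N))"
  unfolding unity_root_def Complex.DeMoivre by (rule arg_cong[of _ _ cis]) simp

lemma unity_root_nonzero [simp]: "unity_root N \<noteq> 0"
  by (simp add: unity_root_def)

lemma unity_root_power_self [simp]: "N > 0 \<Longrightarrow> unity_root N ^ N = 1"
  by (simp add: unity_root_power)

lemma unity_root_power_neq_1:
  assumes "0 < m" "m < N"
  shows "unity_root N ^ m \<noteq> 1"
proof
  assume "unity_root N ^ m = 1"
  then have "cos (2 * (pi * real m / real N)) = 1"
    unfolding unity_root_power by (metis cis.sel(1) one_complex.sel(1))
  then have "sin (pi * real m / real N) = 0" unfolding cos_double_sin by simp
  then show False using cot_sqr_multiple_le(1)[OF assms] by simp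
qed

lemma unity_root_power_inj:
  assumes "i \<in> {1..N}" "l \<in> {1..N}" "unity_root N ^ i = unity_root N ^ l"
  shows "i = l"
proof -
  have False if "i < l" "l \<in> {1..N}" "i \<in> {1..N}" "unity_root N ^ i = unity_root N ^ l" for i l
  proof -
    have "unity_root N ^ (l - i) = 1"
      using that by (simp add: power_diff)
    moreover have "0 < l - i" "l - i < N" using that by auto
    ultimately show False using unity_root_power_neq_1 by blast
  qed
  then show ?thesis using assms by (metis linorder_neqE_nat)
qed

text \<open>The sum is geometric with ratio \<open>?u\<close>, an N-th root of unity that differs
  from 1 unless \<open>i = l\<close>.\<close>

lemma unity_root_orthogonality:
  assumes "i \<in> {1..N}" "l \<in> {1..N}"
  shows "(\<Sum>m<N. (unity_root N ^ m) ^ i * inverse (unity_root N ^ m) ^ l)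
    = (if i = l then of_nat N else 0)"
proof -
  let ?u = "unity_root N ^ i / unity_root N ^ l"
  have "(unity_root N ^ m) ^ i * inverse (unity_root N ^ m) ^ l = ?u ^ m" for m
    by (simp add: divide_inverse power_mult_distrib power_inverse mult.commute flip: power_mult)
  then have "(\<Sum>m<N. (unity_root N ^ m) ^ i * inverse (unity_root N ^ m) ^ l) = (\<Sum>m<N. ?u ^ m)"
    by simp
  also have "\<dots> = (if i = l then of_nat N else 0)"
  proof (cases "i = l")
    case False
    then have "?u \<noteq> 1" using unity_root_power_inj[OF assms] by auto
    moreover have "?u ^ N = 1"
    proof -
      have "(unity_root N ^ j) ^ N = 1" for j
        using assms by (metis power_mult mult.commute power_one unity_root_power_self
            atLeastAtMost_iff less_le_trans zero_less_one)
      then show ?thesis by (simp add: power_divide)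
    qed
    ultimately show ?thesis using False by (simp add: sum_gp_strict)
  qed simp
  finally show ?thesis .
qed

text \<open>Unnormalised Fourier coefficient at frequency \<open>z\<close>, summed over 1 to
  \<open>N\<close> to match the agent labels; the factor \<open>N\<close> reappears in the inversion
  formula.\<close>

definition cycle_dft :: "nat \<Rightarrow> complex \<Rightarrow> (nat \<Rightarrow> complex) \<Rightarrow> complex" where
  "cycle_dft N z f = (\<Sum>l=1..N. inverse z ^ l * f l)"

lemma cycle_dft_inversion:
  assumes "i \<in> {1..N}"
  shows "of_nat N * f i = (\<Sum>m<N. (unity_root N ^ m) ^ i * cycle_dft N (unity_root N ^ m) f)"
proof -
  have "(\<Sum>m<N. (unity_root N ^ m) ^ i * cycle_dft N (unity_root N ^ m) f)
    = (\<Sum>l=1..N. (\<Sum>m<N. (unity_root N ^ m) ^ i * inverse (unity_root N ^ m) ^ l) * f l)"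
    unfolding cycle_dft_def sum_distrib_left sum_distrib_right
    by (subst sum.swap) (simp add: mult_ac)
  also have "\<dots> = (\<Sum>l=1..N. (if i = l then of_nat N else 0) * f l)"
    using assms by (intro sum.cong) (auto simp: unity_root_orthogonality simp del: power_inverse)
  also have "\<dots> = of_nat N * f i"
    using assms by (simp add: if_distrib if_distribR cong: if_cong)
  finally show ?thesis by simp
qed

text \<open>This diagonalises the coupling: passing to the neighbour becomes multiplication by
  \<open>z\<close>. The wrap-around term fits because its weight, the inverse of
  \<open>z ^ N\<close>, is 1.\<close>

lemma cycle_dft_shift:
  assumes "z ^ N = 1"
  shows "cycle_dft N z (\<lambda>l. f (if l = N then 1 else l + 1)) = z * cycle_dft N z f"
proof (cases N)
  case (Suc n)
  then have "z \<noteq> 0" using assms by auto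
  have "inverse z ^ Suc n = 1" using assms Suc by (metis power_inverse inverse_1)
  then have "cycle_dft N z (\<lambda>l. f (if l = N then 1 else l + 1))
    = (\<Sum>l=1..n. inverse z ^ l * f (Suc l)) + f 1"
    unfolding cycle_dft_def Suc by simp
  also have "(\<Sum>l=1..n. inverse z ^ l * f (Suc l)) = (\<Sum>l=1..n. z * (inverse z ^ Suc l * f (Suc l)))"
    using \<open>z \<noteq> 0\<close> by (intro sum.cong) auto
  also have "\<dots> = (\<Sum>l=Suc 1..Suc n. z * (inverse z ^ l * f l))"
    by (rule sum.shift_bounds_cl_Suc_ivl[symmetric])
  \<comment> \<open>The wrapped term \<open>f 1\<close> is exactly the missing summand at index 1,
    where \<open>z\<close> and its inverse cancel.\<close>
  also have "\<dots> + f 1 = (\<Sum>l=1..Suc n. z * (inverse z ^ l * f l))"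
    using \<open>z \<noteq> 0\<close> by (subst (2) sum.atLeast_Suc_atMost) auto
  also have "\<dots> = z * cycle_dft N z f"
    by (simp only: cycle_dft_def Suc sum_distrib_left)
  finally show ?thesis .
qed (simp add: cycle_dft_def)

lemma cycle_dft_has_vector_derivative:
  assumes "\<And>l. l \<in> {1..N} \<Longrightarrow> ((\<lambda>t. f l t) has_vector_derivative f' l) F"
  shows "((\<lambda>t. cycle_dft N z (\<lambda>l. of_real (f l t))) has_vector_derivative
    cycle_dft N z (\<lambda>l. of_real (f' l))) F"
  unfolding cycle_dft_def
  by (intro has_vector_derivative_sum has_vector_derivative_mult_right
      bounded_linear.has_vector_derivative[OF bounded_linear_of_real]) (use assms in auto)

section \<open>Sufficiency of the gain condition\<close>

text \<open>Subtract the inversion formulas for \<open>i\<close> and \<open>j\<close>: the mode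
  \<open>m = 0\<close> has weight 1 in both and cancels, so only the decaying modes remain.\<close>

lemma difference_tendsto_0_if_modes:
  assumes modes: "\<And>m. 0 < m \<Longrightarrow> m < N \<Longrightarrow>
      ((\<lambda>t. cycle_dft N (unity_root N ^ m) (\<lambda>l. of_real (f l t))) \<longlongrightarrow> 0) at_top"
    and ij: "i \<in> {1..N}" "j \<in> {1..N}"
  shows "((\<lambda>t. f i t - f j t :: real) \<longlongrightarrow> 0) at_top"
proof -
  let ?w = "\<lambda>m. unity_root N ^ m"
  let ?F = "\<lambda>m t. cycle_dft N (?w m) (\<lambda>l. of_real (f l t))"
  have "((\<lambda>t. (?w m ^ i - ?w m ^ j) * ?F m t) \<longlongrightarrow> 0) at_top" if "m < N" for m
  proof (cases "m = 0")
    case False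
    then show ?thesis using that by (intro tendsto_mult_right_zero modes) auto
  qed simp
  then have "((\<lambda>t. \<Sum>m<N. (?w m ^ i - ?w m ^ j) * ?F m t) \<longlongrightarrow> 0) at_top"
    by (intro tendsto_null_sum) auto
  moreover have "(\<Sum>m<N. (?w m ^ i - ?w m ^ j) * ?F m t) = of_nat N * of_real (f i t - f j t)" for t
    using cycle_dft_inversion[OF ij(1), of "\<lambda>l. of_real (f l t)"]
      cycle_dft_inversion[OF ij(2), of "\<lambda>l. of_real (f l t)"]
    by (simp add: left_diff_distrib right_diff_distrib sum_subtractf)
  ultimately have "((\<lambda>t. of_nat N * of_real (f i t - f j t) :: complex) \<longlongrightarrow> 0) at_top"
    by simp
  then have "((\<lambda>t. Re (of_nat N * of_real (f i t - f j t)) / N) \<longlongrightarrow> Re 0 / N) at_top"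
    by (intro tendsto_intros) (use ij in auto)
  then show ?thesis using ij by simp
qed

lemma synchronization_if_gain:
  assumes k: "k > 0" and gain: "k > 1 / 2 * (cot (pi / real N))\<^sup>2"
    and sol: "closed_loop_solution N (directed_cycle N) k x"
    and ij: "i \<in> {1..N}" "j \<in> {1..N}"
  shows "((\<lambda>t. x i t - x j t) \<longlongrightarrow> 0) at_top"
proof -
  define P Q where
    "P = (\<lambda>m t. cycle_dft N (unity_root N ^ m) (\<lambda>l. of_real (x l t $ 1)))"
    "Q = (\<lambda>m t. cycle_dft N (unity_root N ^ m) (\<lambda>l. of_real (x l t $ 2)))"
  note PQ = this
  have "(P m \<longlongrightarrow> 0) at_top \<and> (Q m \<longlongrightarrow> 0) at_top" if m: "0 < m" "m < N" for m
  proof -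
    let ?z = "unity_root N ^ m"
    have z: "?z ^ N = 1"
      using m by (metis power_mult mult.commute power_one unity_root_power_self less_trans)
    obtain r1 r2 where r: "r1 + r2 = - (k *\<^sub>R (1 - ?z))" "r1 * r2 = k *\<^sub>R (1 - ?z)"
      by (rule complex_quadratic_roots)
    have "k > 1 / 2 * (cot (pi * real m / real N))\<^sup>2"
      using gain cot_sqr_multiple_le(2)[OF m] by linarith
    then have neg: "Re r1 < 0" "Re r2 < 0"
      using cycle_mode_stable_iff[OF k, of "pi * real m / real N" r1 r2] r
        cot_sqr_multiple_le(1)[OF m] unfolding unity_root_power by auto
    have dQ: "(Q m has_vector_derivative P m t) (at t within {0..})" if "t \<ge> 0" for t
      unfolding PQ using sol that
      by (intro cycle_dft_has_vector_derivative)
        (auto simp: closed_loop_solution_directed_cycle_iff)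
    \<comment> \<open>With \<open>c = k (1 - z)\<close>, the transformed feedback is
      \<open>- c * (P + Q)\<close>; the sum and product of \<open>r1\<close> and \<open>r2\<close>
      turn it into the form required by \<open>second_order_ode_tendsto_0\<close>.\<close>
    have dP: "(P m has_vector_derivative (r1 + r2) * P m t - r1 * r2 * Q m t) (at t within {0..})"
      if "t \<ge> 0" for t
    proof -
      let ?y = "\<lambda>l. complex_of_real (x l t $ 1 + x l t $ 2)"
      have "(P m has_vector_derivative cycle_dft N ?z (\<lambda>l. of_real
          (- k * ((x l t $ 1 + x l t $ 2) - (x (if l = N then 1 else l + 1) t $ 1
            + x (if l = N then 1 else l + 1) t $ 2))))) (at t within {0..})"
        unfolding PQ using sol that unfolding closed_loop_solution_directed_cycle_iff
        by (intro cycle_dft_has_vector_derivative) blast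
      also have "cycle_dft N ?z (\<lambda>l. of_real
          (- k * ((x l t $ 1 + x l t $ 2) - (x (if l = N then 1 else l + 1) t $ 1
            + x (if l = N then 1 else l + 1) t $ 2))))
        = - of_real k * (cycle_dft N ?z ?y - cycle_dft N ?z (\<lambda>l. ?y (if l = N then 1 else l + 1)))"
        unfolding cycle_dft_def sum_subtractf[symmetric] sum_distrib_left
        by (intro sum.cong) (auto simp: algebra_simps)
      also have "\<dots> = - of_real k * (1 - ?z) * cycle_dft N ?z ?y"
        by (subst cycle_dft_shift[OF z]) (simp add: algebra_simps)
      also have "cycle_dft N ?z ?y = P m t + Q m t"
        by (simp add: PQ cycle_dft_def sum.distrib distrib_left)
      also have "- of_real k * (1 - ?z) * (P m t + Q m t) = (r1 + r2) * P m t - r1 * r2 * Q m t"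
        unfolding r by (simp add: scaleR_conv_of_real algebra_simps)
      finally show ?thesis .
    qed
    show ?thesis using second_order_ode_tendsto_0[OF dQ dP neg] by simp
  qed
  then have "((\<lambda>t. x i t $ 1 - x j t $ 1) \<longlongrightarrow> 0) at_top" "((\<lambda>t. x i t $ 2 - x j t $ 2) \<longlongrightarrow> 0) at_top"
    unfolding PQ by (auto intro!: difference_tendsto_0_if_modes[OF _ ij])
  then have "((\<lambda>t. (x i t - x j t) $ n) \<longlongrightarrow> 0 $ n) at_top" for n
    using exhaust_2[of n] by auto
  then show ?thesis by (rule vec_tendstoI)
qed

section \<open>Necessity of the gain condition\<close>

text \<open>Real part of a complex eigensolution with state \<open>(s, 1)\<close> times
  \<open>z ^ i\<close> at agent \<open>i\<close>. The free factor \<open>c\<close> gives access to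
  both the real and the imaginary part of the eigensolution.\<close>

definition mode_solution :: "complex \<Rightarrow> complex \<Rightarrow> complex \<Rightarrow> nat \<Rightarrow> real \<Rightarrow> real^2" where
  "mode_solution s c z i t =
    vector [Re (c * (s * z ^ i) * exp (t *\<^sub>R s)), Re (c * z ^ i * exp (t *\<^sub>R s))]"

text \<open>The hypothesis on \<open>s\<close> is the characteristic equation of the mode
  \<open>z\<close>, and \<open>z ^ N = 1\<close> makes the travelling pattern close up around the
  cycle.\<close>

lemma mode_solution_closed_loop:
  assumes z: "z ^ N = 1" and s: "s * s = - (k *\<^sub>R (1 - z)) * (s + 1)"
  shows "closed_loop_solution N (directed_cycle N) k (mode_solution s c z)"
  unfolding closed_loop_solution_directed_cycle_iff
proof (intro ballI allI impI conjI)
  fix i and t :: real assume i: "i \<in> {1..N}"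
  have dexp: "((\<lambda>t. Re (u * exp (t *\<^sub>R s))) has_vector_derivative Re (u * (exp (t *\<^sub>R s) * s)))
      (at t within {0..})" for u
    by (intro bounded_linear.has_vector_derivative[OF bounded_linear_Re]
        has_vector_derivative_mult_right exp_scaleR_has_vector_derivative_right)
  show "((\<lambda>t. mode_solution s c z i t $ 2) has_vector_derivative mode_solution s c z i t $ 1)
      (at t within {0..})"
    using dexp[of "c * z ^ i"] by (simp add: mode_solution_def mult_ac)
  let ?n = "if i = N then 1 else i + 1"
  \<comment> \<open>At \<open>i = N\<close> the successor is agent 1, and \<open>z * z ^ N\<close>
    is again \<open>z\<close>.\<close>
  have zn: "z ^ ?n = z * z ^ i" using z by simp
  have y: "mode_solution s c z j t $ 1 + mode_solution s c z j t $ 2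
      = Re (c * z ^ j * (s + 1) * exp (t *\<^sub>R s))" for j
    unfolding mode_solution_def vector_2 plus_complex.sel(1)[symmetric]
    by (simp only: algebra_simps mult_1)
  have "Re (c * (s * z ^ i) * (exp (t *\<^sub>R s) * s)) = Re (c * z ^ i * exp (t *\<^sub>R s) * (s * s))"
    by (simp only: mult_ac)
  also have "\<dots> = Re (of_real (- k) * (c * z ^ i * (s + 1) * exp (t *\<^sub>R s)
      - c * z ^ ?n * (s + 1) * exp (t *\<^sub>R s)))"
    unfolding s zn scaleR_conv_of_real of_real_minus
    by (rule arg_cong[of _ _ Re]) (simp add: algebra_simps)
  also have "\<dots> = - k * (Re (c * z ^ i * (s + 1) * exp (t *\<^sub>R s))
      - Re (c * z ^ ?n * (s + 1) * exp (t *\<^sub>R s)))"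
    by (simp only: Re_complex_of_real times_complex.sel Im_complex_of_real minus_complex.sel)
  finally show "((\<lambda>t. mode_solution s c z i t $ 1) has_vector_derivative
      - k * (mode_solution s c z i t $ 1 + mode_solution s c z i t $ 2
        - (mode_solution s c z ?n t $ 1 + mode_solution s c z ?n t $ 2))) (at t within {0..})"
    unfolding y using dexp[of "c * (s * z ^ i)"] by (simp add: mode_solution_def)
qed

text \<open>The difference of agents 1 and 2 carries the factor \<open>z - z\<^sup>2\<close>, which
  is nonzero, and the exponential has modulus at least 1 for nonnegative times, so it cannot
  decay.\<close>

lemma mode_solution_not_synchronized:
  assumes s: "Re s \<ge> 0" and z: "z \<noteq> 1" "z \<noteq> 0"
    and sync: "\<And>c. ((\<lambda>t. mode_solution s c z 1 t - mode_solution s c z 2 t) \<longlongrightarrow> 0) at_top"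
  shows False
proof -
  let ?f = "\<lambda>t. (z - z\<^sup>2) * exp (t *\<^sub>R s)"
  have "((\<lambda>t. Re (c * ?f t)) \<longlongrightarrow> 0) at_top" for c
    using tendsto_vec_nth[OF sync, of c 2] by (simp add: mode_solution_def algebra_simps)
  \<comment> \<open>Multiplication by \<open>- \<i>\<close> moves the imaginary part into the real
    part.\<close>
  from this[of 1] this[of "- \<i>"] have "(?f \<longlongrightarrow> 0) at_top"
    by (subst tendsto_complex_iff) (simp add: algebra_simps)
  then have "((\<lambda>t. norm (?f t)) \<longlongrightarrow> 0) at_top" by (rule tendsto_norm_zero)
  moreover have "\<forall>\<^sub>F t in at_top. norm (z - z\<^sup>2) \<le> norm (?f t)"
    using eventually_ge_at_top[of 0]
    by eventually_elim (use s in \<open>simp add: norm_mult mult_le_cancel_left1\<close>)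
  ultimately have "norm (z - z\<^sup>2) \<le> 0"
    by (intro tendsto_lowerbound) auto
  then show False using z by (simp add: power2_eq_square)
qed

theorem theorem3:
  fixes N :: nat and k :: real
  assumes "N \<ge> 2" and "k > 0"
  shows "(\<forall>x0 :: nat \<Rightarrow> real^2. \<forall>x :: nat \<Rightarrow> real \<Rightarrow> real^2.
            closed_loop_solution N (directed_cycle N) k x \<and> (\<forall>i\<in>{1..N}. x i 0 = x0 i) \<longrightarrow>
            (\<forall>i\<in>{1..N}. \<forall>j\<in>{1..N}. ((\<lambda>t. x i t - x j t) \<longlongrightarrow> 0) at_top))
         \<longleftrightarrow> k > 1 / 2 * (cot (pi / real N))\<^sup>2"
proof (intro iffI)
  assume "k > 1 / 2 * (cot (pi / real N))\<^sup>2"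
  then show "\<forall>x0 :: nat \<Rightarrow> real^2. \<forall>x :: nat \<Rightarrow> real \<Rightarrow> real^2.
      closed_loop_solution N (directed_cycle N) k x \<and> (\<forall>i\<in>{1..N}. x i 0 = x0 i) \<longrightarrow>
      (\<forall>i\<in>{1..N}. \<forall>j\<in>{1..N}. ((\<lambda>t. x i t - x j t) \<longlongrightarrow> 0) at_top)"
    using synchronization_if_gain[OF \<open>k > 0\<close>] by blast
next
  assume sync: "\<forall>x0 :: nat \<Rightarrow> real^2. \<forall>x :: nat \<Rightarrow> real \<Rightarrow> real^2.
      closed_loop_solution N (directed_cycle N) k x \<and> (\<forall>i\<in>{1..N}. x i 0 = x0 i) \<longrightarrow>
      (\<forall>i\<in>{1..N}. \<forall>j\<in>{1..N}. ((\<lambda>t. x i t - x j t) \<longlongrightarrow> 0) at_top)"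
  \<comment> \<open>Only the mode \<open>m = 1\<close> is tested, since its threshold is the claimed
    bound.\<close>
  let ?z = "unity_root N"
  have z: "?z ^ N = 1" "?z \<noteq> 1" "?z \<noteq> 0"
    using assms unity_root_power_neq_1[of 1 N] by auto
  obtain r1 r2 where r: "r1 + r2 = - (k *\<^sub>R (1 - ?z))" "r1 * r2 = k *\<^sub>R (1 - ?z)"
    by (rule complex_quadratic_roots)
  have "Re s < 0" if "s = r1 \<or> s = r2" for s
  proof (rule ccontr)
    assume "\<not> Re s < 0"
    have "s * s = (r1 + r2) * s - r1 * r2" using that by (auto simp: algebra_simps)
    then have "s * s = - (k *\<^sub>R (1 - ?z)) * (s + 1)" unfolding r by (simp add: algebra_simps)
    note solution = mode_solution_closed_loop[OF z(1) this]
    \<comment> \<open>The initial state is read off the mode itself at time 0; agents 1 and 2 both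
      exist because \<open>N \<ge> 2\<close>.\<close>
    have "((\<lambda>t. mode_solution s c ?z 1 t - mode_solution s c ?z 2 t) \<longlongrightarrow> 0) at_top" for c
      using sync[rule_format, of "mode_solution s c ?z" "\<lambda>i. mode_solution s c ?z i 0" 1 2]
        solution assms by simp
    then show False
      using mode_solution_not_synchronized[of s ?z] \<open>\<not> Re s < 0\<close> z by simp
  qed
  moreover have "sin (pi / real N) \<noteq> 0"
    using cot_sqr_multiple_le(1)[of 1 N] assms by simp
  ultimately show "k > 1 / 2 * (cot (pi / real N))\<^sup>2"
    using cycle_mode_stable_iff[OF \<open>k > 0\<close>, of "pi / real N" r1 r2] r
    by (simp add: unity_root_def)
qed

end
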